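(* For any commutative ring $\Omega$, the complex $K(\Omega)$ is not a simplicial decomposition (triangulation) of a compact real surface; that is, the geometric realization of $K(\Omega)$ is not homeomorphic to any compact real surface.
   Context: Rings are commutative with $1\neq0$. $K(\Omega)$ is the clique complex of the zero-divisor graph $\Gamma(\Omega)$, whose vertices are the nonzero zero-divisors of $\Omega$ and in which distinct $a,b$ are adjacent iff $ab=0$. A compact real surface is a compact connected $2$-dimensional topological manifold without boundary (orientable or not). *)

theory Defs
  imports "HOL-Analysis.Analysis" "HOL-Library.Ramsey" "HOL-Algebra.Ring"
begin

section \<open>The zero-divisor graph and its clique complex\<close>

definition nonzero_zero_divisors :: "('a, 'm) ring_scheme \<Rightarrow> 'a set" where
  "nonzero_zero_divisors R =
     {a \<in> carrier R. a \<noteq> \<zero>\<^bsub>R\<^esub> \<and> (\<exists>b\<in>carrier R. b \<noteq> \<zero>\<^bsub>R\<^esub> \<and> a \<otimes>\<^bsub>R\<^esub> b = \<zero>\<^bsub>R\<^esub>)}"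

definition zero_divisor_edges :: "('a, 'm) ring_scheme \<Rightarrow> 'a set set" where
  "zero_divisor_edges R =
     {{a, b} |a b. a \<in> nonzero_zero_divisors R \<and> b \<in> nonzero_zero_divisors R \<and>
                   a \<noteq> b \<and> a \<otimes>\<^bsub>R\<^esub> b = \<zero>\<^bsub>R\<^esub>}"

text \<open>
  An abstract simplicial complex is represented by the set of its nonempty simplices.
\<close>

definition clique_complex :: "'v set \<Rightarrow> 'v set set \<Rightarrow> 'v set set" where
  "clique_complex V E = {\<sigma>. \<sigma> \<subseteq> V \<and> finite \<sigma> \<and> \<sigma> \<noteq> {} \<and> clique \<sigma> E}"

definition zero_divisor_complex :: "('a, 'm) ring_scheme \<Rightarrow> 'a set set" where
  "zero_divisor_complex R = clique_complex (nonzero_zero_divisors R) (zero_divisor_edges R)"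


section \<open>Geometric realization\<close>

text \<open>
  Points are given by their barycentric coordinates.  For a finite vertex set, the product
  topology induces the usual Euclidean topology on the closed simplex.
\<close>

definition closed_simplex :: "'v set \<Rightarrow> ('v \<Rightarrow> real) set" where
  "closed_simplex \<sigma> = {x. (\<forall>v. 0 \<le> x v) \<and> (\<forall>v. v \<notin> \<sigma> \<longrightarrow> x v = 0) \<and> (\<Sum>v\<in>\<sigma>. x v) = 1}"

text \<open>
  The realization carries the weak (coherent) topology with respect to its closed simplices; this
  matters when the complex is infinite.
\<close>

definition geometric_realization :: "'v set set \<Rightarrow> ('v \<Rightarrow> real) topology" where
  "geometric_realization K = topology (\<lambda>U. U \<subseteq> (\<Union>\<sigma>\<in>K. closed_simplex \<sigma>) \<and>
     (\<forall>\<sigma>\<in>K. openin (subtopology (powertop_real UNIV) (closed_simplex \<sigma>)) (U \<inter> closed_simplex \<sigma>)))"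

lemma openin_geometric_realization:
  "openin (geometric_realization K) U \<longleftrightarrow> U \<subseteq> (\<Union>\<sigma>\<in>K. closed_simplex \<sigma>) \<and>
     (\<forall>\<sigma>\<in>K. openin (subtopology (powertop_real UNIV) (closed_simplex \<sigma>)) (U \<inter> closed_simplex \<sigma>))"
proof -
  let ?S = "\<lambda>\<sigma>::'a set. subtopology (powertop_real UNIV) (closed_simplex \<sigma>)"
  let ?P = "\<lambda>U. U \<subseteq> (\<Union>\<sigma>\<in>K. closed_simplex \<sigma>) \<and> (\<forall>\<sigma>\<in>K. openin (?S \<sigma>) (U \<inter> closed_simplex \<sigma>))"
  have "istopology ?P"
    unfolding istopology_def
  proof (intro conjI allI impI)
    fix A B assume "?P A" "?P B"
    then have "openin (?S \<sigma>) ((A \<inter> closed_simplex \<sigma>) \<inter> (B \<inter> closed_simplex \<sigma>))" if "\<sigma> \<in> K" for \<sigma>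
      using that by blast
    moreover have "(A \<inter> closed_simplex \<sigma>) \<inter> (B \<inter> closed_simplex \<sigma>) = A \<inter> B \<inter> closed_simplex \<sigma>" for \<sigma>
      by blast
    ultimately show "\<forall>\<sigma>\<in>K. openin (?S \<sigma>) (A \<inter> B \<inter> closed_simplex \<sigma>)"
      by simp
    show "A \<inter> B \<subseteq> (\<Union>\<sigma>\<in>K. closed_simplex \<sigma>)"
      using \<open>?P A\<close> by blast
  next
    fix \<U> assume \<U>: "\<forall>A\<in>\<U>. ?P A"
    then show "\<Union>\<U> \<subseteq> (\<Union>\<sigma>\<in>K. closed_simplex \<sigma>)"
      by blast
    have "openin (?S \<sigma>) (\<Union>A\<in>\<U>. A \<inter> closed_simplex \<sigma>)" if "\<sigma> \<in> K" for \<sigma>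
      using \<U> that by (intro openin_Union) auto
    moreover have "(\<Union>A\<in>\<U>. A \<inter> closed_simplex \<sigma>) = \<Union>\<U> \<inter> closed_simplex \<sigma>" for \<sigma>
      by blast
    ultimately show "\<forall>\<sigma>\<in>K. openin (?S \<sigma>) (\<Union>\<U> \<inter> closed_simplex \<sigma>)"
      by simp
  qed
  then show ?thesis
    by (simp add: geometric_realization_def topology_inverse')
qed

lemma topspace_geometric_realization:
  "topspace (geometric_realization K) = (\<Union>\<sigma>\<in>K. closed_simplex \<sigma>)"
proof (rule antisym)
  show "topspace (geometric_realization K) \<subseteq> (\<Union>\<sigma>\<in>K. closed_simplex \<sigma>)"
    using openin_topspace openin_geometric_realization by blast
  have "openin (geometric_realization K) (\<Union>\<sigma>\<in>K. closed_simplex \<sigma>)"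
    unfolding openin_geometric_realization
  proof (intro conjI ballI)
    fix \<sigma> assume "\<sigma> \<in> K"
    then have "(\<Union>\<sigma>\<in>K. closed_simplex \<sigma>) \<inter> closed_simplex \<sigma> = closed_simplex \<sigma>"
      by blast
    then show "openin (subtopology (powertop_real UNIV) (closed_simplex \<sigma>))
                 ((\<Union>\<sigma>\<in>K. closed_simplex \<sigma>) \<inter> closed_simplex \<sigma>)"
      using openin_topspace[of "subtopology (powertop_real UNIV) (closed_simplex \<sigma>)"] by simp
  qed simp
  then show "(\<Union>\<sigma>\<in>K. closed_simplex \<sigma>) \<subseteq> topspace (geometric_realization K)"
    by (rule openin_subset)
qed


section \<open>Compact surfaces\<close>

definition topological_manifold :: "nat \<Rightarrow> 'b topology \<Rightarrow> bool" where
  "topological_manifold n X \<longleftrightarrow> Hausdorff_space X \<and> second_countable X \<and>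
     (\<forall>x\<in>topspace X. \<exists>U V. openin X U \<and> x \<in> U \<and> openin (Euclidean_space n) V \<and>
        subtopology X U homeomorphic_space subtopology (Euclidean_space n) V)"

text \<open>
  \<^const>\<open>connected_space\<close> holds for the empty space, which also is vacuously a manifold; it has to
  be excluded, since the complex of an integral domain is empty.
\<close>

definition compact_real_surface :: "'b topology \<Rightarrow> bool" where
  "compact_real_surface X \<longleftrightarrow>
     topspace X \<noteq> {} \<and> compact_space X \<and> connected_space X \<and> topological_manifold 2 X"

end

theory Submission
  imports Defs "HOL-Homology.Invariance_of_Domain"
begin

text \<open>
  A triangulated closed surface has three combinatorial properties: every vertex lies on an edge,
  every edge lies in exactly two triangles, and there is no tetrahedron.  No ring has a
  zero-divisor complex with all three.

  The topological half only uses invariance of domain, which makes injective continuous maps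
  between the plane and a surface open, in both directions
  (\<open>open_image_from_locally_Euclidean\<close>, \<open>open_image_into_locally_Euclidean\<close>).  If an edge lay in at
  most one triangle, its open star would map injectively to a half-plane, with the midpoint of the
  edge landing on the boundary line, and such an image is not open in the plane; the star of a
  vertex without edges is a single point and is excluded in the same way
  (\<open>not_subset_singleton_opposite_vertices\<close>, \<open>vertex_in_edge\<close>).  If an edge lay in three triangles,
  two of them would already contain a disc around the midpoint, which would be open although the
  third triangle accumulates at the midpoint.  Likewise the interior of a triangle would be open
  although a tetrahedron on that triangle accumulates at it (\<open>two_opposite_vertices\<close>).

  In the ring, the third vertices over an edge \<open>a\<close>, \<open>b\<close> are the elements of the ideal
  \<open>I = Ann a \<inter> Ann b\<close> other than \<open>0\<close>, \<open>a\<close>, \<open>b\<close>.  There are thus exactly two of them, \<open>c\<close> and \<open>d\<close>, and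
  \<open>c d\<close> is nonzero because there is no tetrahedron.  Additive closure of these tiny ideals forces
  all vertices to have nonzero squares; then \<open>I = {0, c, -c}\<close>, and \<open>a\<^sup>2 = \<plusminus>a\<close> for every vertex of a
  triangle, as in the octahedron formed by the multiples of the coordinate vectors of a product of
  three fields with three elements.  For a triangle \<open>a\<close>, \<open>b\<close>, \<open>c\<close> the element \<open>a + b\<close> is then a
  further vertex adjacent to \<open>c\<close>, and this edge lies in no triangle at all
  (\<open>edge_links_not_all_two_nonadjacent_vertices\<close>).
\<close>

section \<open>Invariance of domain in locally Euclidean spaces\<close>

definition locally_Euclidean :: "nat \<Rightarrow> 'b topology \<Rightarrow> bool" where
  "locally_Euclidean n X \<longleftrightarrow>
     (\<forall>x\<in>topspace X. \<exists>U V. openin X U \<and> x \<in> U \<and> openin (Euclidean_space n) V \<and>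
        subtopology X U homeomorphic_space subtopology (Euclidean_space n) V)"

lemma topspace_subtopology_open: "openin X U \<Longrightarrow> topspace (subtopology X U) = U"
  by (meson openin_subset topspace_subtopology_subset)

lemma locally_Euclidean_chart:
  assumes "locally_Euclidean n X" "x \<in> topspace X"
  obtains W V h k where "openin X W" "x \<in> W" "openin (Euclidean_space n) V"
    "h ` W = V" "k ` V = W" "\<And>w. w \<in> W \<Longrightarrow> k (h w) = w" "\<And>v. v \<in> V \<Longrightarrow> h (k v) = v"
    "continuous_map (subtopology X W) (Euclidean_space n) h"
    "continuous_map (subtopology (Euclidean_space n) V) X k"
proof -
  obtain W V where W: "openin X W" "x \<in> W" and V: "openin (Euclidean_space n) V"
    and "subtopology X W homeomorphic_space subtopology (Euclidean_space n) V"
    using assms unfolding locally_Euclidean_def by blast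
  then obtain h k where hk: "homeomorphic_maps (subtopology X W) (subtopology (Euclidean_space n) V) h k"
    unfolding homeomorphic_space_def by blast
  have tops: "topspace (subtopology X W) = W" "topspace (subtopology (Euclidean_space n) V) = V"
    using W V by (simp_all only: topspace_subtopology_open)
  have inv: "\<And>w. w \<in> W \<Longrightarrow> k (h w) = w" "\<And>v. v \<in> V \<Longrightarrow> h (k v) = v"
    and "continuous_map (subtopology X W) (subtopology (Euclidean_space n) V) h"
    and "continuous_map (subtopology (Euclidean_space n) V) (subtopology X W) k"
    using hk tops unfolding homeomorphic_maps_def by auto
  then have cont: "continuous_map (subtopology X W) (Euclidean_space n) h"
    "continuous_map (subtopology (Euclidean_space n) V) X k"
    and "h ` W \<subseteq> V" "k ` V \<subseteq> W"
    using tops by (auto simp: continuous_map_in_subtopology)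
  then have "h ` W = V" "k ` V = W"
    using inv by (force intro: image_eqI)+
  then show ?thesis
    using that W V inv cont by blast
qed

lemma locally_Euclidean_homeomorphic_space:
  assumes X: "locally_Euclidean n X" and "Y homeomorphic_space X"
  shows "locally_Euclidean n Y"
  unfolding locally_Euclidean_def
proof
  fix y assume y: "y \<in> topspace Y"
  obtain f where f: "homeomorphic_map Y X f"
    using assms(2) homeomorphic_space by blast
  then have "f y \<in> topspace X"
    using y homeomorphic_imp_surjective_map by blast
  then obtain W V where W: "openin X W" "f y \<in> W" and V: "openin (Euclidean_space n) V"
    and hom: "subtopology X W homeomorphic_space subtopology (Euclidean_space n) V"
    using X unfolding locally_Euclidean_def by blast
  let ?U = "{z \<in> topspace Y. f z \<in> W}"
  have "openin Y ?U"
    using openin_continuous_map_preimage[OF homeomorphic_imp_continuous_map[OF f]] W by blast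
  moreover have "f ` (topspace Y \<inter> ?U) = topspace X \<inter> W"
    using homeomorphic_imp_surjective_map[OF f] by auto
  then have "homeomorphic_map (subtopology Y ?U) (subtopology X W) f"
    using homeomorphic_map_subtopologies_alt homeomorphic_map_subtopologies[OF f] by blast
  then have "subtopology Y ?U homeomorphic_space subtopology X W"
    using homeomorphic_space by blast
  then have "subtopology Y ?U homeomorphic_space subtopology (Euclidean_space n) V"
    using hom homeomorphic_space_trans by blast
  ultimately show "\<exists>U V. openin Y U \<and> y \<in> U \<and> openin (Euclidean_space n) V \<and>
        subtopology Y U homeomorphic_space subtopology (Euclidean_space n) V"
    using y W V by blast
qed

text \<open>Read in a chart of \<open>X\<close>, the map \<open>g\<close> goes from an open subset of Euclidean space to Euclidean
  space of the same dimension, so that invariance of domain applies near every point.\<close>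

lemma open_image_from_locally_Euclidean:
  assumes X: "locally_Euclidean n X" and U: "openin X U"
    and g: "continuous_map (subtopology X U) (Euclidean_space n) g" and "inj_on g U"
  shows "openin (Euclidean_space n) (g ` U)"
proof (subst openin_subopen, clarify)
  fix x assume x: "x \<in> U"
  then have "x \<in> topspace X"
    using U openin_subset by blast
  then obtain W V h k where W: "openin X W" "x \<in> W" and V: "openin (Euclidean_space n) V"
    and im: "h ` W = V" "k ` V = W" and inv: "\<And>v. v \<in> V \<Longrightarrow> h (k v) = v"
    and k: "continuous_map (subtopology (Euclidean_space n) V) X k"
    using locally_Euclidean_chart[OF X] by metis
  let ?V = "{v \<in> V. k v \<in> U}"
  have "openin (subtopology (Euclidean_space n) V) {v \<in> topspace (subtopology (Euclidean_space n) V). k v \<in> U}"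
    using k U openin_continuous_map_preimage by blast
  then have oV: "openin (Euclidean_space n) ?V"
    using V by (simp only: openin_open_subtopology topspace_subtopology_open)
  have "continuous_map (subtopology (Euclidean_space n) ?V) X k"
    using k by (rule continuous_map_from_subtopology_mono) auto
  then have "continuous_map (subtopology (Euclidean_space n) ?V) (subtopology X U) k"
    by (auto simp: continuous_map_in_subtopology)
  then have "continuous_map (subtopology (Euclidean_space n) ?V) (Euclidean_space n) (g \<circ> k)"
    by (rule continuous_map_compose[OF _ g])
  moreover have "inj_on k ?V"
    using inv by (intro inj_on_inverseI[of _ h]) auto
  then have "inj_on (g \<circ> k) ?V"
    by (rule comp_inj_on) (auto intro: inj_on_subset[OF \<open>inj_on g U\<close>])
  ultimately have "openin (Euclidean_space n) ((g \<circ> k) ` ?V)"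
    by (rule invariance_of_domain_Euclidean_space[OF oV])
  moreover have "x \<in> k ` V"
    using im W by simp
  then obtain v where "v \<in> V" "k v = x"
    by auto
  then have "g x \<in> (g \<circ> k) ` ?V"
    using x by (force intro!: image_eqI[of _ _ v])
  ultimately show "\<exists>T. openin (Euclidean_space n) T \<and> g x \<in> T \<and> T \<subseteq> g ` U"
    by (intro exI[of _ "(g \<circ> k) ` ?V"]) auto
qed

text \<open>This is invariance of domain for \<open>f\<close> followed by a chart; the chart carries openness of the image
  back to \<open>X\<close>.\<close>

lemma open_image_into_locally_Euclidean:
  assumes X: "locally_Euclidean n X" and D: "openin (Euclidean_space n) D"
    and f: "continuous_map (subtopology (Euclidean_space n) D) X f" and inj: "inj_on f D"
  shows "openin X (f ` D)"
proof (subst openin_subopen, clarify)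
  fix z assume z: "z \<in> D"
  have topD: "topspace (subtopology (Euclidean_space n) D) = D"
    using D by (rule topspace_subtopology_open)
  then have "f z \<in> topspace X"
    using f z continuous_map_image_subset_topspace by blast
  then obtain W V h k where W: "openin X W" "f z \<in> W" and V: "openin (Euclidean_space n) V"
    and im: "h ` W = V" and inv: "\<And>w. w \<in> W \<Longrightarrow> k (h w) = w"
    and inv': "\<And>v. v \<in> V \<Longrightarrow> h (k v) = v" and kim: "k ` V = W"
    and h: "continuous_map (subtopology X W) (Euclidean_space n) h"
    using locally_Euclidean_chart[OF X] by metis
  let ?D = "{u \<in> D. f u \<in> W}"
  have "openin (subtopology (Euclidean_space n) D) {u \<in> topspace (subtopology (Euclidean_space n) D). f u \<in> W}"
    using f W openin_continuous_map_preimage by blast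
  then have oD: "openin (Euclidean_space n) ?D"
    using D by (simp only: topD openin_open_subtopology)
  have "continuous_map (subtopology (Euclidean_space n) ?D) X f"
    using f by (rule continuous_map_from_subtopology_mono) auto
  then have "continuous_map (subtopology (Euclidean_space n) ?D) (subtopology X W) f"
    by (auto simp: continuous_map_in_subtopology)
  then have "continuous_map (subtopology (Euclidean_space n) ?D) (Euclidean_space n) (h \<circ> f)"
    by (rule continuous_map_compose[OF _ h])
  moreover have injh: "inj_on h W"
    by (rule inj_on_inverseI) (rule inv)
  have "inj_on (h \<circ> f) ?D"
    by (rule comp_inj_on) (auto intro: inj_on_subset[OF inj] inj_on_subset[OF injh])
  ultimately have B: "openin (Euclidean_space n) ((h \<circ> f) ` ?D)"
    by (rule invariance_of_domain_Euclidean_space[OF oD])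
  \<comment> \<open>The part of the image inside \<open>W\<close> is the preimage under the chart \<open>h\<close> of this open set.\<close>
  have "openin (subtopology X W) {w \<in> topspace (subtopology X W). h w \<in> (h \<circ> f) ` ?D}"
    using h B openin_continuous_map_preimage by blast
  moreover have "topspace (subtopology X W) = W"
    using W by (simp only: topspace_subtopology_open)
  moreover have "{w \<in> W. h w \<in> (h \<circ> f) ` ?D} = f ` ?D"
    by (auto dest: inj_onD[OF injh])
  ultimately have "openin X (f ` ?D)"
    using W by (simp only: openin_open_subtopology)
  then show "\<exists>T. openin X T \<and> f z \<in> T \<and> T \<subseteq> f ` D"
    using z W by (intro exI[of _ "f ` ?D"]) auto
qed


section \<open>Maps into and out of a geometric realization\<close>

lemma continuous_map_realization_coordinate:
  "continuous_map (geometric_realization K) euclideanreal (\<lambda>x. x v)"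
  unfolding continuous_map_def
proof (intro conjI allI impI)
  fix T :: "real set" assume T: "openin euclideanreal T"
  have "continuous_map (powertop_real UNIV) euclideanreal (\<lambda>x :: 'a \<Rightarrow> real. x v)"
    by (rule continuous_map_product_projection) simp
  then have "openin (powertop_real UNIV) {x :: 'a \<Rightarrow> real. x v \<in> T}"
    using T openin_continuous_map_preimage[of "powertop_real UNIV" euclideanreal "\<lambda>x. x v" T]
    by simp
  moreover have "{x \<in> topspace (geometric_realization K). x v \<in> T} \<inter> closed_simplex \<sigma>
      = {x. x v \<in> T} \<inter> closed_simplex \<sigma>" if "\<sigma> \<in> K" for \<sigma>
    using that by (auto simp: topspace_geometric_realization)
  ultimately show "openin (geometric_realization K) {x \<in> topspace (geometric_realization K). x v \<in> T}"
    by (auto simp: openin_geometric_realization topspace_geometric_realization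
        openin_subtopology_Int)
qed auto

text \<open>The weak topology agrees with the product topology on a single closed simplex, so continuity into
  one simplex can be checked coordinatewise.  A map that meets several simplices has to be pasted
  together from such pieces.\<close>

lemma continuous_map_into_realization_simplex:
  assumes "\<sigma> \<in> K" and f: "\<And>v. continuous_map X euclideanreal (\<lambda>z. f z v)"
    and im: "\<And>z. z \<in> topspace X \<Longrightarrow> f z \<in> closed_simplex \<sigma>"
  shows "continuous_map X (geometric_realization K) f"
proof -
  have f': "continuous_map X (subtopology (powertop_real UNIV) (closed_simplex \<sigma>)) f"
    using f im by (simp add: continuous_map_in_subtopology continuous_map_componentwise_UNIV Pi_iff)
  show ?thesis
    unfolding continuous_map_def
  proof (intro conjI allI impI)
    show "f \<in> topspace X \<rightarrow> topspace (geometric_realization K)"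
      using im \<open>\<sigma> \<in> K\<close> by (auto simp: topspace_geometric_realization)
    fix T assume "openin (geometric_realization K) T"
    then have "openin (subtopology (powertop_real UNIV) (closed_simplex \<sigma>)) (T \<inter> closed_simplex \<sigma>)"
      using \<open>\<sigma> \<in> K\<close> by (simp add: openin_geometric_realization)
    then have "openin X {z \<in> topspace X. f z \<in> T \<inter> closed_simplex \<sigma>}"
      using f' openin_continuous_map_preimage by blast
    moreover have "{z \<in> topspace X. f z \<in> T \<inter> closed_simplex \<sigma>} = {z \<in> topspace X. f z \<in> T}"
      using im by auto
    ultimately show "openin X {z \<in> topspace X. f z \<in> T}"
      by simp
  qed
qed

lemma openin_realization_positive_coordinate:
  "openin (geometric_realization K) {x \<in> topspace (geometric_realization K). 0 < x v}"
proof -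
  have "openin (geometric_realization K) {x \<in> topspace (geometric_realization K). x v \<in> {0<..}}"
    by (rule openin_continuous_map_preimage[OF continuous_map_realization_coordinate]) simp
  then show ?thesis
    by simp
qed

text \<open>
  Moving a point of a closed simplex linearly towards one of the vertices is continuous, so a short
  move stays in \<open>U\<close>.  Hence a subset of a face that leaves out the vertex \<open>v\<close> is not open at points of
  a simplex containing \<open>v\<close>; this rules out third pages at an edge and tetrahedra.
\<close>

lemma open_meets_positive_coordinate:
  assumes U: "openin (geometric_realization K) U" and "\<sigma> \<in> K" "finite \<sigma>" "v \<in> \<sigma>"
    and p: "p \<in> U" "p \<in> closed_simplex \<sigma>"
  shows "\<exists>x\<in>U. 0 < x v"
proof -
  define f where "f = (\<lambda>(t::real) w. (1 - t) * p w + (if w = v then t else 0))"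
  let ?I = "subtopology euclideanreal {0..1}"
  have "f t \<in> closed_simplex \<sigma>" if "t \<in> {0..1}" for t
  proof -
    have "(\<Sum>w\<in>\<sigma>. f t w) = (1 - t) * (\<Sum>w\<in>\<sigma>. p w) + t"
      using \<open>finite \<sigma>\<close> \<open>v \<in> \<sigma>\<close> by (simp add: f_def sum.distrib sum_distrib_left)
    then show ?thesis
      using p that \<open>v \<in> \<sigma>\<close> by (auto simp: closed_simplex_def f_def)
  qed
  moreover have "continuous_map ?I euclideanreal (\<lambda>t. f t w)" for w
    unfolding f_def by (cases "w = v") (auto intro!: continuous_intros)
  ultimately have "continuous_map ?I (geometric_realization K) f"
    using \<open>\<sigma> \<in> K\<close> by (intro continuous_map_into_realization_simplex) auto
  then have "openin ?I {t \<in> topspace ?I. f t \<in> U}"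
    using U openin_continuous_map_preimage by blast
  then obtain T where T: "open T" "{t \<in> {0..1}. f t \<in> U} = {0..1} \<inter> T"
    by (auto simp: openin_open)
  have "f 0 = p"
    by (auto simp: f_def)
  then have "0 \<in> T"
    using p T by fastforce
  then obtain e where e: "e > 0" "\<And>t. dist t 0 < e \<Longrightarrow> t \<in> T"
    using \<open>open T\<close> open_dist by metis
  define t where "t = min 1 (e / 2)"
  have "t \<in> {0..1} \<inter> T" "0 < t"
    using e by (auto simp: t_def)
  then have "f t \<in> U"
    using T by blast
  moreover have "0 < f t v"
    using p \<open>0 < t\<close> by (simp add: f_def closed_simplex_def t_def add_nonneg_pos)
  ultimately show ?thesis
    by blast
qed


section \<open>Triangulated surfaces\<close>

text \<open>The vertical line through \<open>p\<close> would meet \<open>B\<close> in points below \<open>p\<close>.\<close>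

lemma not_open_in_half_plane:
  assumes B: "openin (Euclidean_space 2) B" and half: "\<And>z. z \<in> B \<Longrightarrow> 0 \<le> z 1"
    and p: "p \<in> B" "p 1 = 0"
  shows False
proof -
  have pE: "p \<in> topspace (Euclidean_space 2)"
    using B p openin_subset by blast
  have "continuous_map euclideanreal (Euclidean_space 2)
      (\<lambda>t i. if i < 2 then (if i = 1 then t else p i) else 0)"
    unfolding continuous_map_componentwise_Euclidean_space
  proof (intro allI impI)
    fix i :: nat
    show "continuous_map euclideanreal euclideanreal (\<lambda>t. if i = 1 then t else p i)"
      by (cases "i = 1") auto
  qed
  moreover have "(\<lambda>i. if i < 2 then (if i = 1 then t else p i) else 0) = p(1 := t)" for t
    using pE by (auto simp: topspace_Euclidean_space fun_eq_iff)
  ultimately have "continuous_map euclideanreal (Euclidean_space 2) (\<lambda>t. p(1 := t))"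
    by simp
  then have "openin euclideanreal {t \<in> topspace euclideanreal. p(1 := t) \<in> B}"
    using B by (rule openin_continuous_map_preimage)
  then have "open {t. p(1 := t) \<in> B}"
    by simp
  moreover have "p(1 := 0) = p"
    using p by (auto simp: fun_eq_iff)
  then have "0 \<in> {t. p(1 := t) \<in> B}"
    using p by simp
  ultimately obtain e where e: "e > 0" "\<And>t. dist t 0 < e \<Longrightarrow> p(1 := t) \<in> B"
    unfolding open_dist by blast
  then have "p(1 := - (e / 2)) \<in> B"
    by simp
  then show False
    using half e by fastforce
qed

lemma sum_coordinates_eq_1:
  assumes "x \<in> closed_simplex \<sigma>" "finite \<sigma>" "finite \<tau>" "\<And>v. v \<notin> \<tau> \<Longrightarrow> x v = 0"
  shows "(\<Sum>v\<in>\<tau>. x v) = 1"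
proof -
  have "(\<Sum>v\<in>\<tau>. x v) = (\<Sum>v\<in>\<sigma> \<inter> \<tau>. x v)"
    using assms by (intro sum.mono_neutral_right) (auto simp: closed_simplex_def)
  also have "\<dots> = (\<Sum>v\<in>\<sigma>. x v)"
    using assms by (intro sum.mono_neutral_left) auto
  finally show ?thesis
    using assms(1) by (simp add: closed_simplex_def)
qed

text \<open>Two triangles \<open>{a, b, c}\<close> and \<open>{a, b, d}\<close> with the common edge \<open>{a, b}\<close> unfold into a planar rhombus:
  the edge lies on the horizontal axis, \<open>c\<close> is the top corner \<open>(0, 1)\<close> and \<open>d\<close> the bottom corner
  \<open>(0, -1)\<close>.  The points of the open rhombus are those at which the coordinates at both \<open>a\<close> and \<open>b\<close> are
  positive, and \<open>two_pages\<close> folds it back.\<close>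

definition open_diamond :: "(nat \<Rightarrow> real) set" where
  "open_diamond = {z \<in> topspace (Euclidean_space 2). \<bar>z 0\<bar> < (1 - \<bar>z 1\<bar>) / 2}"

definition two_pages :: "'v \<Rightarrow> 'v \<Rightarrow> 'v \<Rightarrow> 'v \<Rightarrow> (nat \<Rightarrow> real) \<Rightarrow> 'v \<Rightarrow> real" where
  "two_pages a b c d z = (\<lambda>v. if v = a then (1 - \<bar>z 1\<bar>) / 2 - z 0
     else if v = b then (1 - \<bar>z 1\<bar>) / 2 + z 0
     else if v = c then max (z 1) 0 else if v = d then max (- z 1) 0 else 0)"

lemma continuous_map_Euclidean_coordinate:
  "continuous_map (subtopology (Euclidean_space n) D) euclideanreal (\<lambda>z. z i)"
  unfolding Euclidean_space_def
  by (intro continuous_map_from_subtopology continuous_map_product_projection) simp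

lemma openin_open_diamond: "openin (Euclidean_space 2) open_diamond"
proof -
  have c: "continuous_map (Euclidean_space 2) euclideanreal (\<lambda>z. z i)" for i
    using continuous_map_Euclidean_coordinate[of 2 UNIV i] by simp
  have "continuous_map (Euclidean_space 2) euclideanreal (\<lambda>z. (1 - \<bar>z 1\<bar>) / 2 - \<bar>z 0\<bar>)"
    by (intro continuous_intros c) auto
  then have "openin (Euclidean_space 2)
      {z \<in> topspace (Euclidean_space 2). (1 - \<bar>z 1\<bar>) / 2 - \<bar>z 0\<bar> \<in> {0<..}}"
    by (rule openin_continuous_map_preimage) simp
  then show ?thesis
    by (simp add: open_diamond_def)
qed

lemma openin_upper_open_diamond: "openin (Euclidean_space 2) {z \<in> open_diamond. 0 < z 1}"
proof -
  have "openin (subtopology (Euclidean_space 2) open_diamond)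
      {z \<in> topspace (subtopology (Euclidean_space 2) open_diamond). z 1 \<in> {0<..}}"
    by (rule openin_continuous_map_preimage[OF continuous_map_Euclidean_coordinate]) simp
  then have "openin (Euclidean_space 2)
      {z \<in> topspace (subtopology (Euclidean_space 2) open_diamond). z 1 \<in> {0<..}}"
    using openin_open_diamond by (simp only: openin_open_subtopology)
  then show ?thesis
    by (simp only: topspace_subtopology_open[OF openin_open_diamond] greaterThan_iff)
qed

lemma two_pages_in_closed_simplex:
  assumes "distinct [a, b, c, d]" "z \<in> open_diamond"
  shows "0 \<le> z 1 \<Longrightarrow> two_pages a b c d z \<in> closed_simplex {a, b, c}"
    and "z 1 \<le> 0 \<Longrightarrow> two_pages a b c d z \<in> closed_simplex {a, b, d}"
proof -
  have "- z 0 < (1 - \<bar>z 1\<bar>) / 2" "z 0 < (1 - \<bar>z 1\<bar>) / 2"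
    using assms(2) unfolding open_diamond_def abs_less_iff by auto
  then have "0 \<le> (1 - \<bar>z 1\<bar>) / 2 - z 0" "0 \<le> (1 - \<bar>z 1\<bar>) / 2 + z 0"
    by linarith+
  then have nonneg: "0 \<le> two_pages a b c d z v" for v
    unfolding two_pages_def by auto
  show "two_pages a b c d z \<in> closed_simplex {a, b, c}" if "0 \<le> z 1"
    using assms(1) that nonneg by (auto simp: closed_simplex_def two_pages_def add_divide_distrib diff_divide_distrib)
  show "two_pages a b c d z \<in> closed_simplex {a, b, d}" if "z 1 \<le> 0"
    using assms(1) that nonneg by (auto simp: closed_simplex_def two_pages_def add_divide_distrib diff_divide_distrib)
qed

text \<open>The coordinates at \<open>c\<close> and \<open>d\<close> are the positive and the negative part of the height, and together
  with the coordinate at \<open>a\<close> they determine the point.\<close>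

lemma inj_on_two_pages:
  assumes "distinct [a, b, c, d]"
  shows "inj_on (two_pages a b c d) (topspace (Euclidean_space 2))"
proof (rule inj_onI)
  fix z w assume E: "z \<in> topspace (Euclidean_space 2)" "w \<in> topspace (Euclidean_space 2)"
    and eq: "two_pages a b c d z = two_pages a b c d w"
  have c: "max (z 1) 0 = max (w 1) 0" and d: "max (- z 1) 0 = max (- w 1) 0"
    using fun_cong[OF eq, of c] fun_cong[OF eq, of d] assms by (auto simp: two_pages_def)
  have z1: "z 1 = w 1"
    using c d by (auto simp: max_def split: if_splits)
  moreover have "z 0 = w 0"
    using fun_cong[OF eq, of a] z1 by (simp add: two_pages_def)
  moreover have "i = 0 \<or> i = 1 \<or> 2 \<le> i" for i :: nat
    by linarith
  ultimately show "z = w"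
    using E unfolding fun_eq_iff topspace_Euclidean_space by (metis (mono_tags, lifting) mem_Collect_eq)
qed

lemma continuous_map_two_pages:
  assumes abc: "distinct [a, b, c, d]" "{a, b, c} \<in> K" "{a, b, d} \<in> K" and D: "D \<subseteq> open_diamond"
  shows "continuous_map (subtopology (Euclidean_space 2) D) (geometric_realization K) (two_pages a b c d)"
proof -
  let ?E = "subtopology (Euclidean_space 2) D"
  have coord: "continuous_map (subtopology ?E T) euclideanreal (\<lambda>z. two_pages a b c d z v)" for T v
  proof -
    have c: "continuous_map (subtopology ?E T) euclideanreal (\<lambda>z. z i)" for i
      by (simp only: subtopology_subtopology continuous_map_Euclidean_coordinate)
    then show ?thesis
      unfolding two_pages_def
      by (cases "v = a"; cases "v = b"; cases "v = c"; cases "v = d"; simp; intro continuous_intros c; simp)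
  qed
  have "continuous_map ?E (geometric_realization K)
      (\<lambda>z. if 0 \<le> z 1 then two_pages a b c d z else two_pages a b c d z)"
  proof (rule continuous_map_cases_le)
    show "continuous_map ?E euclideanreal (\<lambda>z. z 1)"
      by (rule continuous_map_Euclidean_coordinate)
    show "continuous_map (subtopology ?E {z \<in> topspace ?E. 0 \<le> z 1}) (geometric_realization K)
        (two_pages a b c d)"
      using D by (intro continuous_map_into_realization_simplex[OF abc(2) coord]
          two_pages_in_closed_simplex[OF abc(1)]) auto
    show "continuous_map (subtopology ?E {z \<in> topspace ?E. z 1 \<le> 0}) (geometric_realization K)
        (two_pages a b c d)"
      using D by (intro continuous_map_into_realization_simplex[OF abc(3) coord]
          two_pages_in_closed_simplex[OF abc(1)]) auto
  qed auto
  then show ?thesis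
    by simp
qed

locale triangulated_surface =
  fixes K :: "'v set set"
  assumes finite_simplex: "\<sigma> \<in> K \<Longrightarrow> finite \<sigma>"
    and face: "\<sigma> \<in> K \<Longrightarrow> \<tau> \<subseteq> \<sigma> \<Longrightarrow> \<tau> \<noteq> {} \<Longrightarrow> \<tau> \<in> K"
    and surface: "locally_Euclidean 2 (geometric_realization K)"
begin

abbreviation opposite_vertices :: "'v \<Rightarrow> 'v \<Rightarrow> 'v set" where
  "opposite_vertices a b \<equiv> {c. c \<noteq> a \<and> c \<noteq> b \<and> {a, b, c} \<in> K}"

lemma simplex_of_positive_coordinates:
  assumes "x \<in> closed_simplex \<sigma>" "\<sigma> \<in> K" "\<tau> \<noteq> {}" "\<And>v. v \<in> \<tau> \<Longrightarrow> x v \<noteq> 0"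
  shows "\<tau> \<in> K"
  using assms by (intro face[of \<sigma> \<tau>]) (auto simp: closed_simplex_def)

text \<open>A surface without boundary has no boundary points: an open set cannot be placed injectively in a
  half-plane so that a point of it comes to lie on the boundary line.\<close>

lemma no_half_plane_chart:
  assumes U: "openin (geometric_realization K) U" and "inj_on (\<lambda>x. (f x, g x)) U"
    and f: "continuous_map (geometric_realization K) euclideanreal f"
    and g: "continuous_map (geometric_realization K) euclideanreal g"
    and half: "\<And>x. x \<in> U \<Longrightarrow> 0 \<le> g x" and p: "p \<in> U" "g p = 0"
  shows False
proof -
  let ?h = "\<lambda>x i. if i < 2 then (if i = (0::nat) then f x else g x) else 0"
  have "continuous_map (subtopology (geometric_realization K) U) (Euclidean_space 2) ?h"
    unfolding continuous_map_componentwise_Euclidean_space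
  proof (intro allI impI)
    fix i :: nat
    show "continuous_map (subtopology (geometric_realization K) U) euclideanreal
        (\<lambda>x. if i = 0 then f x else g x)"
      using f g by (cases "i = 0") (auto intro: continuous_map_from_subtopology)
  qed
  moreover have "inj_on ?h U"
  proof (rule inj_onI)
    fix x y assume "x \<in> U" "y \<in> U" and eq: "?h x = ?h y"
    moreover have "f x = f y" "g x = g y"
      using fun_cong[OF eq, of 0] fun_cong[OF eq, of 1] by simp_all
    ultimately show "x = y"
      using inj_onD[OF assms(2)] by blast
  qed
  ultimately have "openin (Euclidean_space 2) (?h ` U)"
    using open_image_from_locally_Euclidean[OF surface U] by blast
  then show False
    by (rule not_open_in_half_plane[where p = "?h p"]) (use p half in auto)
qed

text \<open>Otherwise the open star of \<open>a\<close> consists of the vertex alone, and a constant map places this open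
  set on the boundary line of a half-plane.\<close>

lemma vertex_in_edge:
  assumes "{a} \<in> K"
  obtains b where "b \<noteq> a" "{a, b} \<in> K"
proof (rule ccontr)
  assume "\<not> thesis"
  then have none: "\<And>v. v \<noteq> a \<Longrightarrow> {a, v} \<notin> K"
    using that by blast
  define p where "p = (\<lambda>v. if v = a then 1 else 0 :: real)"
  let ?U = "{x \<in> topspace (geometric_realization K). 0 < x a}"
  have "x = p" if x: "x \<in> ?U" for x
  proof -
    obtain \<sigma> where \<sigma>: "\<sigma> \<in> K" "x \<in> closed_simplex \<sigma>"
      using x by (auto simp: topspace_geometric_realization)
    have z: "x v = 0" if "v \<notin> {a}" for v
    proof (rule ccontr)
      assume "x v \<noteq> 0"
      then have "{a, v} \<in> K"
        using x by (intro simplex_of_positive_coordinates[OF \<sigma>(2,1)]) auto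
      then show False
        using none that by auto
    qed
    have "x a = 1"
      using sum_coordinates_eq_1[OF \<sigma>(2) finite_simplex[OF \<sigma>(1)], of "{a}"] z by simp
    then show ?thesis
      using z by (auto simp: p_def fun_eq_iff)
  qed
  then have "inj_on (\<lambda>x. (0::real, 0::real)) ?U"
    by (metis (no_types, lifting) inj_onI)
  moreover have "p \<in> closed_simplex {a}"
    by (auto simp: p_def closed_simplex_def)
  then have "p \<in> ?U"
    using assms by (auto simp: p_def topspace_geometric_realization)
  ultimately show False
    using no_half_plane_chart[where U = ?U and f = "\<lambda>_. 0" and g = "\<lambda>_. 0" and p = p,
        OF openin_realization_positive_coordinate]
    by simp
qed

text \<open>If \<open>c\<close> is the only candidate for a third vertex, a point \<open>x\<close> of the open star of the edge is
  determined by \<open>x a\<close> and \<open>x b\<close>, and \<open>1 - x a - x b\<close> is its coordinate at \<open>c\<close>, or zero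
  if there is no third vertex at all.  This number is nonnegative on the star and vanishes on the edge, so it can serve as the height over the boundary line.\<close>

lemma not_subset_singleton_opposite_vertices:
  assumes ab: "{a, b} \<in> K" "a \<noteq> b"
  shows "\<not> opposite_vertices a b \<subseteq> {c}"
proof
  assume sub: "opposite_vertices a b \<subseteq> {c}"
  let ?U = "{x \<in> topspace (geometric_realization K). 0 < x a} \<inter>
            {x \<in> topspace (geometric_realization K). 0 < x b}"
  have star: "(\<forall>v. v \<notin> {a, b, c} \<longrightarrow> x v = 0) \<and> (\<Sum>v\<in>{a, b, c}. x v) = 1 \<and> (\<forall>v. 0 \<le> x v)"
    if x: "x \<in> ?U" for x
  proof -
    obtain \<sigma> where \<sigma>: "\<sigma> \<in> K" "x \<in> closed_simplex \<sigma>"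
      using x by (auto simp: topspace_geometric_realization)
    have z: "x v = 0" if "v \<notin> {a, b, c}" for v
    proof (rule ccontr)
      assume "x v \<noteq> 0"
      then have "{a, b, v} \<in> K"
        using x by (intro simplex_of_positive_coordinates[OF \<sigma>(2,1)]) auto
      then show False
        using sub that by auto
    qed
    then show ?thesis
      using sum_coordinates_eq_1[OF \<sigma>(2) finite_simplex[OF \<sigma>(1)], of "{a, b, c}"] \<sigma>(2)
      unfolding closed_simplex_def by blast
  qed
  have third: "(\<Sum>v\<in>{a, b, c}. x v) = x a + x b + (if c = a \<or> c = b then 0 else x c)" for x :: "'v \<Rightarrow> real"
    using ab by (auto simp: insert_commute)
  have inj: "inj_on (\<lambda>x. (x a, 1 - x a - x b)) ?U"
  proof (rule inj_onI)
    fix x y assume xy: "x \<in> ?U" "y \<in> ?U" and eq: "(x a, 1 - x a - x b) = (y a, 1 - y a - y b)"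
    have "x v = y v" for v
      using star[OF xy(1)] star[OF xy(2)] eq third[of x] third[of y]
      by (cases "v \<in> {a, b, c}") (auto split: if_splits)
    then show "x = y"
      by blast
  qed
  have half: "0 \<le> 1 - x a - x b" if "x \<in> ?U" for x
  proof -
    have "0 \<le> x c" "x a + x b + (if c = a \<or> c = b then 0 else x c) = 1"
      using star[OF that] third[of x] by simp_all
    then show ?thesis
      by (auto split: if_splits)
  qed
  define p where "p = (\<lambda>v. if v \<in> {a, b} then 1 / 2 else 0 :: real)"
  have "p \<in> closed_simplex {a, b}"
    using ab by (auto simp: p_def closed_simplex_def)
  then have p: "p \<in> ?U" "1 - p a - p b = 0"
    using ab by (auto simp: p_def topspace_geometric_realization)
  have open_U: "openin (geometric_realization K) ?U"
    by (intro openin_Int openin_realization_positive_coordinate)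
  have cont: "continuous_map (geometric_realization K) euclideanreal (\<lambda>x. 1 - x a - x b)"
    by (intro continuous_intros continuous_map_realization_coordinate) auto
  show False
    by (rule no_half_plane_chart[OF open_U inj continuous_map_realization_coordinate cont half p])
qed

lemma two_pages_open_image:
  assumes "distinct [a, b, c, d]" "{a, b, c} \<in> K" "{a, b, d} \<in> K"
    and D: "openin (Euclidean_space 2) D" "D \<subseteq> open_diamond"
  shows "openin (geometric_realization K) (two_pages a b c d ` D)"
proof (rule open_image_into_locally_Euclidean[OF surface D(1)])
  show "inj_on (two_pages a b c d) D"
    using inj_on_two_pages[OF assms(1)] openin_subset[OF D(1)] by (rule inj_on_subset)
qed (rule continuous_map_two_pages[OF assms(1-3) D(2)])

text \<open>The open upper half of the rhombus covers the interior of the triangle \<open>{a, b, c}\<close>, which is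
  therefore open, although the tetrahedron leads away from it towards \<open>d\<close>.\<close>

lemma no_tetrahedron:
  assumes "distinct [a, b, c, d]"
  shows "{a, b, c, d} \<notin> K"
proof
  assume K: "{a, b, c, d} \<in> K"
  have faces: "{a, b, c} \<in> K" "{a, b, d} \<in> K"
    by (rule face[OF K]; auto)+
  let ?D = "{z \<in> open_diamond. 0 < z 1}" and ?z = "\<lambda>i. if i = (1::nat) then 1 / 2 else 0 :: real"
  have z: "?z \<in> ?D"
    by (auto simp: open_diamond_def topspace_Euclidean_space)
  have "two_pages a b c d ?z \<in> closed_simplex {a, b, c, d}"
    using assms by (auto simp: closed_simplex_def two_pages_def)
  then obtain x where "x \<in> two_pages a b c d ` ?D" "0 < x d"
    using open_meets_positive_coordinate[OF two_pages_open_image[OF assms faces openin_upper_open_diamond] K,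
        of d "two_pages a b c d ?z"] z by blast
  then show False
    using assms by (auto simp: two_pages_def)
qed

text \<open>The pages at \<open>c\<close> and \<open>d\<close> contain a neighbourhood of the midpoint of the edge, from which the page at
  \<open>e\<close> leads away.\<close>

lemma no_three_opposite_vertices:
  assumes "distinct [a, b, c, d, e]" "{a, b, c} \<in> K" "{a, b, d} \<in> K" and e: "{a, b, e} \<in> K"
  shows False
proof -
  have dist: "distinct [a, b, c, d]"
    using assms by simp
  let ?z = "\<lambda>i::nat. 0 :: real"
  have z: "?z \<in> open_diamond"
    by (auto simp: open_diamond_def topspace_Euclidean_space)
  have "two_pages a b c d ?z \<in> closed_simplex {a, b, e}"
    using assms by (auto simp: closed_simplex_def two_pages_def)
  then obtain x where "x \<in> two_pages a b c d ` open_diamond" "0 < x e"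
    using open_meets_positive_coordinate[OF two_pages_open_image[OF dist assms(2,3) openin_open_diamond] e,
        of e "two_pages a b c d ?z"] z by blast
  then show False
    using assms by (auto simp: two_pages_def)
qed

lemma two_opposite_vertices:
  assumes "{a, b} \<in> K" "a \<noteq> b"
  obtains c d where "c \<noteq> d" "opposite_vertices a b = {c, d}" "{a, b, c, d} \<notin> K"
proof -
  obtain c where c: "c \<in> opposite_vertices a b"
    using not_subset_singleton_opposite_vertices[OF assms, of a] by blast
  obtain d where d: "d \<in> opposite_vertices a b" "d \<noteq> c"
    using not_subset_singleton_opposite_vertices[OF assms, of c] by blast
  have "e \<in> {c, d}" if "e \<in> opposite_vertices a b" for e
    using no_three_opposite_vertices[of a b c d e] assms c d that by auto
  then have "opposite_vertices a b = {c, d}"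
    using c d by (intro equalityI subsetI) auto
  moreover have "{a, b, c, d} \<notin> K"
    using no_tetrahedron[of a b c d] assms c d by auto
  ultimately show thesis
    using that[of c d] d by simp
qed

end


section \<open>Zero divisors\<close>

context cring
begin

abbreviation common_annihilator :: "'a \<Rightarrow> 'a \<Rightarrow> 'a set" where
  "common_annihilator a b \<equiv> {x \<in> carrier R. a \<otimes> x = \<zero> \<and> b \<otimes> x = \<zero>}"

lemma common_annihilator_add_closed:
  assumes "a \<in> carrier R" "b \<in> carrier R"
    and "x \<in> common_annihilator a b" "y \<in> common_annihilator a b"
  shows "x \<oplus> y \<in> common_annihilator a b"
  using assms by (auto simp: r_distr)

text \<open>The hypothesis describes the zero-divisor graph of a ring whose complex is a surface: the link of
  each edge consists of two vertices that are not adjacent.  Four facts follow in turn: at most one end has square zero, since otherwise \<open>Ann a \<inter> Ann b\<close> is an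
  additive group of order five, generated by \<open>a\<close>, so that \<open>c d = 0\<close>; no vertex \<open>a\<close> of a triangle has
  square zero, since the link of the opposite edge would be \<open>a\<close> and \<open>-a\<close>, with product zero; the third vertices are \<open>c\<close> and \<open>-c\<close>,
  because their sum is a common annihilator and cannot be anything but zero; and \<open>a\<^sup>2 = \<plusminus>a\<close>, because \<open>a\<^sup>2\<close>
  annihilates the opposite edge too.\<close>

lemma edge_links_not_all_two_nonadjacent_vertices:
  assumes third: "\<And>a b. a \<in> carrier R \<Longrightarrow> b \<in> carrier R \<Longrightarrow> a \<noteq> \<zero> \<Longrightarrow> b \<noteq> \<zero> \<Longrightarrow> a \<noteq> b \<Longrightarrow>
      a \<otimes> b = \<zero> \<Longrightarrow> \<exists>c d. c \<noteq> d \<and> c \<otimes> d \<noteq> \<zero> \<and> common_annihilator a b - {\<zero>, a, b} = {c, d}"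
    and "a0 \<in> carrier R" "b0 \<in> carrier R" "a0 \<noteq> \<zero>" "b0 \<noteq> \<zero>" "a0 \<noteq> b0" "a0 \<otimes> b0 = \<zero>"
  shows False
proof -
  define edge where "edge a b \<longleftrightarrow> a \<in> carrier R \<and> b \<in> carrier R \<and> a \<noteq> \<zero> \<and> b \<noteq> \<zero> \<and> a \<noteq> b \<and>
      a \<otimes> b = \<zero>" for a b
  have thirdE: "\<exists>c d. edge a c \<and> edge b c \<and> edge a d \<and> edge b d \<and> c \<noteq> d \<and> c \<otimes> d \<noteq> \<zero> \<and>
      (\<forall>x\<in>common_annihilator a b. x = \<zero> \<or> x = a \<or> x = b \<or> x = c \<or> x = d)"
    if "edge a b" for a b
  proof -
    obtain c d where "c \<noteq> d" "c \<otimes> d \<noteq> \<zero>" and eq: "common_annihilator a b - {\<zero>, a, b} = {c, d}"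
      using third[of a b] \<open>edge a b\<close> unfolding edge_def by blast
    moreover have "c \<in> common_annihilator a b - {\<zero>, a, b}" "d \<in> common_annihilator a b - {\<zero>, a, b}"
      using eq by auto
    moreover have "x = \<zero> \<or> x = a \<or> x = b \<or> x = c \<or> x = d" if "x \<in> common_annihilator a b" for x
      using eq that by blast
    moreover from calculation have "edge a c" "edge b c" "edge a d" "edge b d"
      using \<open>edge a b\<close> by (auto simp: edge_def)
    ultimately show ?thesis
      by blast
  qed
  have sym: "edge b a" if "edge a b" for a b
    using that by (auto simp: edge_def m_comm)
  have add_eq: "x \<oplus> y = x \<longleftrightarrow> y = \<zero>" "y \<oplus> x = x \<longleftrightarrow> y = \<zero>"
    if "x \<in> carrier R" "y \<in> carrier R" for x y
    using that by auto
  have not_both: False if ab: "edge a b" and sq: "a \<otimes> a = \<zero>" "b \<otimes> b = \<zero>" for a b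
  proof -
    obtain c d where e: "edge a c" "edge b c" "edge a d" "edge b d" "c \<noteq> d" "c \<otimes> d \<noteq> \<zero>"
      and I: "\<forall>x\<in>common_annihilator a b. x = \<zero> \<or> x = a \<or> x = b \<or> x = c \<or> x = d"
      using thirdE[OF ab] by blast
    have C: "a \<in> carrier R" "b \<in> carrier R" "c \<in> carrier R" "d \<in> carrier R"
      and nz: "a \<noteq> \<zero>" "b \<noteq> \<zero>" "c \<noteq> \<zero>" "d \<noteq> \<zero>"
      and ne: "a \<noteq> b" "a \<noteq> c" "a \<noteq> d" "b \<noteq> c" "b \<noteq> d"
      and z: "a \<otimes> b = \<zero>" "b \<otimes> a = \<zero>" "a \<otimes> c = \<zero>" "a \<otimes> d = \<zero>" "b \<otimes> c = \<zero>" "b \<otimes> d = \<zero>"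
        "c \<otimes> a = \<zero>" "c \<otimes> b = \<zero>" "d \<otimes> a = \<zero>" "d \<otimes> b = \<zero>"
      using ab e sym[OF ab] sym[OF e(1)] sym[OF e(2)] sym[OF e(3)] sym[OF e(4)]
      by (auto simp: edge_def)
    \<comment> \<open>Sums of \<open>a\<close> and \<open>b\<close> kill \<open>c\<close> and \<open>d\<close>, so neither \<open>c\<close> nor \<open>d\<close> is such a sum.\<close>
    have combo: "x \<oplus> y \<noteq> c" "x \<oplus> y \<noteq> d" if "x \<in> {a, b}" "y \<in> {a, b}" for x y
    proof -
      show "x \<oplus> y \<noteq> c"
      proof
        assume "x \<oplus> y = c"
        then have "c \<otimes> d = (x \<oplus> y) \<otimes> d"
          by simp
        also have "\<dots> = \<zero>"
          using that C z by (auto simp: l_distr)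
        finally show False using e by simp
      qed
      show "x \<oplus> y \<noteq> d"
      proof
        assume "x \<oplus> y = d"
        then have "c \<otimes> d = c \<otimes> (x \<oplus> y)"
          by simp
        also have "\<dots> = \<zero>"
          using that C z by (auto simp: r_distr)
        finally show False using e by simp
      qed
    qed
    have "a \<oplus> b \<in> common_annihilator a b" "a \<oplus> c \<in> common_annihilator a b"
      "a \<oplus> d \<in> common_annihilator a b"
      using C z sq by (auto simp: r_distr)
    moreover have "a \<oplus> b \<noteq> a" "a \<oplus> b \<noteq> b" "a \<oplus> c \<noteq> a" "a \<oplus> c \<noteq> c" "a \<oplus> d \<noteq> a" "a \<oplus> d \<noteq> d"
      using add_eq C nz by simp_all
    ultimately have ab0: "a \<oplus> b = \<zero>"
      and ac: "a \<oplus> c = b \<or> a \<oplus> c = d \<or> a \<oplus> c = \<zero>" and ad: "a \<oplus> d = b \<or> a \<oplus> d = c \<or> a \<oplus> d = \<zero>"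
      using I combo by blast+
    have b: "b = \<ominus> a"
      using ab0 C by (metis a_comm minus_equality)
    have "x = b" if "x \<in> carrier R" "a \<oplus> x = \<zero>" for x
      using that b C by (metis a_comm minus_equality)
    then have "a \<oplus> c \<noteq> \<zero>" "a \<oplus> d \<noteq> \<zero>"
      using ne C by blast+
    moreover have "a \<oplus> x = b \<longleftrightarrow> x = b \<oplus> b" if "x \<in> carrier R" for x
      using C that b by (metis a_assoc a_inv_closed l_neg l_zero r_neg)
    then have "a \<oplus> c \<noteq> b" "a \<oplus> d \<noteq> b"
      using combo[of b b] C by auto
    \<comment> \<open>Translation by \<open>a\<close> swaps \<open>c\<close> and \<open>d\<close>, so \<open>a\<close> has additive order two, against \<open>b = -a\<close>.\<close>
    ultimately have "a \<oplus> c = d" "a \<oplus> d = c"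
      using ac ad by auto
    then have "(a \<oplus> a) \<oplus> c = c"
      using C by (simp add: a_assoc)
    then have "a \<oplus> a = \<zero>"
      using C by simp
    then show False
      using b ne C by (metis minus_equality)
  qed
  have square_nonzero: "a \<otimes> a \<noteq> \<zero>" if ab: "edge a b" for a b
  proof
    assume a2: "a \<otimes> a = \<zero>"
    obtain c where "edge a c" "edge b c"
      using thirdE[OF ab] by blast
    have b2: "b \<otimes> b \<noteq> \<zero>" and c2: "c \<otimes> c \<noteq> \<zero>"
      using a2 not_both ab \<open>edge a c\<close> by blast+
    obtain u v where uv: "edge b u" "edge c u" "edge b v" "edge c v" "u \<noteq> v" "u \<otimes> v \<noteq> \<zero>"
      and I: "\<forall>x\<in>common_annihilator b c. x = \<zero> \<or> x = b \<or> x = c \<or> x = u \<or> x = v"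
      using thirdE[OF \<open>edge b c\<close>] by blast
    have C: "a \<in> carrier R" "b \<in> carrier R" "c \<in> carrier R"
      and nz: "a \<noteq> \<zero>" "a \<noteq> b" "a \<noteq> c" "b \<noteq> c"
      and z: "b \<otimes> a = \<zero>" "c \<otimes> a = \<zero>" "b \<otimes> c = \<zero>"
      using ab \<open>edge a c\<close> \<open>edge b c\<close> by (auto simp: edge_def m_comm)
    have nsq: "b \<notin> common_annihilator b c" "c \<notin> common_annihilator b c"
      using b2 c2 by auto
    have "a \<in> common_annihilator b c"
      using C z by simp
    then have "a = u \<or> a = v"
      using I nz by blast
    \<comment> \<open>\<open>w\<close> is the other third vertex of the edge \<open>b\<close>, \<open>c\<close>.\<close>
    then obtain w where w: "edge b w" "edge c w" "a \<noteq> w" "a \<otimes> w \<noteq> \<zero>"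
      and I': "\<forall>x\<in>common_annihilator b c. x = \<zero> \<or> x = a \<or> x = w"
    proof
      assume "a = u"
      then show thesis
        using that[of v] uv I nsq by blast
    next
      assume "a = v"
      then have "a \<otimes> u \<noteq> \<zero>"
        using uv by (simp add: edge_def m_comm)
      then show thesis
        using that[of u] uv I nsq \<open>a = v\<close> by blast
    qed
    have wC: "w \<in> carrier R" "w \<noteq> \<zero>" "w \<in> common_annihilator b c"
      using w by (auto simp: edge_def)
    have "a \<oplus> w \<in> common_annihilator b c"
      using common_annihilator_add_closed C wC \<open>a \<in> common_annihilator b c\<close> by blast
    moreover have "a \<oplus> w \<noteq> a" "a \<oplus> w \<noteq> w"
      using add_eq C wC nz by simp_all
    ultimately have "a \<oplus> w = \<zero>"
      using I' by blast
    then have "w = \<ominus> a"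
      using C wC by (metis a_comm minus_equality)
    then have "a \<otimes> w = \<zero>"
      using C a2 by (simp add: r_minus)
    then show False
      using w by simp
  qed
  have third_opposite: "\<exists>c. edge a c \<and> edge b c \<and>
      (\<forall>x\<in>common_annihilator a b. x = \<zero> \<or> x = c \<or> x = \<ominus> c)"
    if ab: "edge a b" for a b
  proof -
    obtain c d where cd: "edge a c" "edge b c" "edge a d" "edge b d" "c \<noteq> d"
      and I: "\<forall>x\<in>common_annihilator a b. x = \<zero> \<or> x = a \<or> x = b \<or> x = c \<or> x = d"
      using thirdE[OF ab] by blast
    have C: "a \<in> carrier R" "b \<in> carrier R" "c \<in> common_annihilator a b" "d \<in> common_annihilator a b"
      and nz: "c \<noteq> \<zero>" "d \<noteq> \<zero>"
      using cd by (auto simp: edge_def)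
    have nsq: "\<forall>x\<in>common_annihilator a b. x \<noteq> a \<and> x \<noteq> b"
      using square_nonzero ab sym by blast
    have "c \<oplus> d \<in> common_annihilator a b"
      using common_annihilator_add_closed C by blast
    moreover have "c \<oplus> d \<noteq> c" "c \<oplus> d \<noteq> d"
      using add_eq C nz by simp_all
    ultimately have "c \<oplus> d = \<zero>"
      using I nsq by blast
    then have "d = \<ominus> c"
      using C by (metis (mono_tags, lifting) a_comm mem_Collect_eq minus_equality)
    then have "\<forall>x\<in>common_annihilator a b. x = \<zero> \<or> x = c \<or> x = \<ominus> c"
      using I nsq by blast
    then show ?thesis
      using cd by blast
  qed
  have "edge a0 b0"
    using assms by (simp add: edge_def)
  then obtain a b where ab: "edge a b"
    by blast
  obtain c where c: "edge a c" "edge b c"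
    and Ic: "\<forall>x\<in>common_annihilator a b. x = \<zero> \<or> x = c \<or> x = \<ominus> c"
    using third_opposite[OF ab] by blast
  \<comment> \<open>Up to sign, \<open>a'\<close> will be \<open>a\<close> itself.\<close>
  obtain a' where Ia: "\<forall>x\<in>common_annihilator b c. x = \<zero> \<or> x = a' \<or> x = \<ominus> a'"
    and a': "edge b a'"
    using third_opposite[OF c(2)] by blast
  have C: "a \<in> carrier R" "b \<in> carrier R" "c \<in> carrier R" "a' \<in> carrier R"
    and nz: "a \<noteq> \<zero>" "b \<noteq> \<zero>" "c \<noteq> \<zero>"
    and z: "a \<otimes> b = \<zero>" "b \<otimes> a = \<zero>" "a \<otimes> c = \<zero>" "c \<otimes> a = \<zero>" "b \<otimes> c = \<zero>" "c \<otimes> b = \<zero>"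
    using ab c a' by (auto simp: edge_def m_comm)
  have sq: "a \<otimes> a \<noteq> \<zero>" "b \<otimes> b \<noteq> \<zero>" "c \<otimes> c \<noteq> \<zero>"
    using square_nonzero ab c sym by blast+
  have a2: "a \<otimes> a = a \<or> a \<otimes> a = \<ominus> a"
  proof -
    have "a = a' \<or> a = \<ominus> a'"
      using Ia[rule_format, of a] C z nz by simp
    moreover have "b \<otimes> (a \<otimes> a) = \<zero>" "c \<otimes> (a \<otimes> a) = \<zero>"
      using C z by (metis m_assoc l_null)+
    then have "a \<otimes> a = a' \<or> a \<otimes> a = \<ominus> a'"
      using Ia[rule_format, of "a \<otimes> a"] C sq by simp
    ultimately show ?thesis
      using C by (auto simp: minus_minus)
  qed
  \<comment> \<open>A third vertex \<open>x\<close> over this edge is killed by \<open>a\<^sup>2 = \<plusminus>a\<close>, hence by \<open>a\<close> and \<open>b\<close>, so that it is \<open>\<plusminus>c\<close>;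
    but \<open>c x = 0\<close>.\<close>
  have "edge (a \<oplus> b) c"
  proof -
    have "a \<oplus> b \<noteq> \<zero>"
    proof
      assume "a \<oplus> b = \<zero>"
      then have "a \<otimes> a \<oplus> a \<otimes> b = \<zero>"
        using C by (metis r_distr r_null)
      then show False using sq C z by simp
    qed
    moreover have z': "(a \<oplus> b) \<otimes> c = \<zero>"
      using C z by (simp add: l_distr)
    moreover have "a \<oplus> b \<noteq> c"
      using z' sq by auto
    ultimately show ?thesis
      using C nz by (simp add: edge_def)
  qed
  then obtain x where x: "edge (a \<oplus> b) x" "edge c x"
    using thirdE by blast
  then have xC: "x \<in> carrier R" "x \<noteq> \<zero>" "(a \<oplus> b) \<otimes> x = \<zero>" "c \<otimes> x = \<zero>"
    by (auto simp: edge_def)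
  then have sum: "a \<otimes> x \<oplus> b \<otimes> x = \<zero>"
    using C by (simp add: l_distr)
  have "(a \<otimes> a) \<otimes> x = a \<otimes> (a \<otimes> x \<oplus> b \<otimes> x)"
    using C xC z by (simp add: r_distr flip: m_assoc)
  then have "(a \<otimes> a) \<otimes> x = \<zero>"
    using sum C by simp
  then have ax: "a \<otimes> x = \<zero>"
    using a2 C xC by (metis l_minus m_closed minus_minus minus_zero)
  then have "b \<otimes> x = \<zero>"
    using sum C xC by simp
  then have "x = c \<or> x = \<ominus> c"
    using Ic[rule_format, of x] ax xC by simp
  then have "c \<otimes> c = \<zero>"
    using xC C by (metis r_minus m_closed minus_minus minus_zero)
  then show False
    using sq by simp
qed

end

text \<open>Commutativity enters because the edge \<open>{x, y}\<close> records the product in an unspecified order.\<close>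

lemma zero_divisor_complex_iff:
  assumes "cring R"
  shows "\<sigma> \<in> zero_divisor_complex R \<longleftrightarrow> finite \<sigma> \<and> \<sigma> \<noteq> {} \<and> (\<forall>x\<in>\<sigma>. x \<in> nonzero_zero_divisors R) \<and>
    (\<forall>x\<in>\<sigma>. \<forall>y\<in>\<sigma>. x \<noteq> y \<longrightarrow> x \<otimes>\<^bsub>R\<^esub> y = \<zero>\<^bsub>R\<^esub>)"
proof (cases "\<sigma> \<subseteq> nonzero_zero_divisors R")
  case True
  have "{x, y} \<in> zero_divisor_edges R \<longleftrightarrow> x \<otimes>\<^bsub>R\<^esub> y = \<zero>\<^bsub>R\<^esub>"
    if "x \<in> \<sigma>" "y \<in> \<sigma>" "x \<noteq> y" for x y
  proof
    assume "{x, y} \<in> zero_divisor_edges R"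
    then obtain a b where ab: "{x, y} = {a, b}" "a \<in> carrier R" "b \<in> carrier R" "a \<otimes>\<^bsub>R\<^esub> b = \<zero>\<^bsub>R\<^esub>"
      by (auto simp: zero_divisor_edges_def nonzero_zero_divisors_def)
    moreover have "b \<otimes>\<^bsub>R\<^esub> a = \<zero>\<^bsub>R\<^esub>"
      using ab cring.cring_simprules(14)[OF assms, of a b] by simp
    ultimately show "x \<otimes>\<^bsub>R\<^esub> y = \<zero>\<^bsub>R\<^esub>"
      by (auto simp: doubleton_eq_iff)
  next
    assume "x \<otimes>\<^bsub>R\<^esub> y = \<zero>\<^bsub>R\<^esub>"
    then show "{x, y} \<in> zero_divisor_edges R"
      using that True unfolding zero_divisor_edges_def by blast
  qed
  then have "clique \<sigma> (zero_divisor_edges R) \<longleftrightarrow> (\<forall>x\<in>\<sigma>. \<forall>y\<in>\<sigma>. x \<noteq> y \<longrightarrow> x \<otimes>\<^bsub>R\<^esub> y = \<zero>\<^bsub>R\<^esub>)"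
    by (simp add: clique_def)
  then show ?thesis
    using True by (auto simp: zero_divisor_complex_def clique_complex_def)
qed (auto simp: zero_divisor_complex_def clique_complex_def)

theorem theorem4p3:
  fixes \<Omega> :: "('a, 'm) ring_scheme" and S :: "'b topology"
  assumes "cring \<Omega>" and "\<one>\<^bsub>\<Omega>\<^esub> \<noteq> \<zero>\<^bsub>\<Omega>\<^esub>"
    and "compact_real_surface S"
  shows "\<not> geometric_realization (zero_divisor_complex \<Omega>) homeomorphic_space S"
proof
  interpret cring \<Omega> by fact
  let ?K = "zero_divisor_complex \<Omega>"
  assume hom: "geometric_realization ?K homeomorphic_space S"
  have "locally_Euclidean 2 S" "topspace S \<noteq> {}"
    using assms(3) by (auto simp: compact_real_surface_def topological_manifold_def locally_Euclidean_def)
  have K: "\<sigma> \<in> ?K \<longleftrightarrow> finite \<sigma> \<and> \<sigma> \<noteq> {} \<and> (\<forall>x\<in>\<sigma>. x \<in> nonzero_zero_divisors \<Omega>) \<and>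
      (\<forall>x\<in>\<sigma>. \<forall>y\<in>\<sigma>. x \<noteq> y \<longrightarrow> x \<otimes>\<^bsub>\<Omega>\<^esub> y = \<zero>\<^bsub>\<Omega>\<^esub>)" for \<sigma>
    using zero_divisor_complex_iff[OF assms(1)] .
  interpret triangulated_surface ?K
  proof
    fix \<sigma> \<tau> assume "\<sigma> \<in> ?K"
    then show "finite \<sigma>"
      by (simp add: K)
    assume "\<tau> \<subseteq> \<sigma>" "\<tau> \<noteq> {}"
    moreover have "finite \<tau>"
      using \<open>finite \<sigma>\<close> \<open>\<tau> \<subseteq> \<sigma>\<close> by (rule rev_finite_subset)
    ultimately show "\<tau> \<in> ?K"
      using \<open>\<sigma> \<in> ?K\<close> by (auto simp: K)
  next
    show "locally_Euclidean 2 (geometric_realization ?K)"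
      using \<open>locally_Euclidean 2 S\<close> hom by (rule locally_Euclidean_homeomorphic_space)
  qed
  have simplex2: "{a, b} \<in> ?K"
    if "a \<in> carrier \<Omega>" "b \<in> carrier \<Omega>" "a \<noteq> \<zero>\<^bsub>\<Omega>\<^esub>" "b \<noteq> \<zero>\<^bsub>\<Omega>\<^esub>" "a \<otimes>\<^bsub>\<Omega>\<^esub> b = \<zero>\<^bsub>\<Omega>\<^esub>" for a b
    using that m_comm[of a b] by (auto simp: K nonzero_zero_divisors_def)
  have exactly_two: "\<exists>c d. c \<noteq> d \<and> c \<otimes>\<^bsub>\<Omega>\<^esub> d \<noteq> \<zero>\<^bsub>\<Omega>\<^esub> \<and> common_annihilator a b - {\<zero>\<^bsub>\<Omega>\<^esub>, a, b} = {c, d}"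
    if ab: "a \<in> carrier \<Omega>" "b \<in> carrier \<Omega>" "a \<noteq> \<zero>\<^bsub>\<Omega>\<^esub>" "b \<noteq> \<zero>\<^bsub>\<Omega>\<^esub>" "a \<noteq> b" "a \<otimes>\<^bsub>\<Omega>\<^esub> b = \<zero>\<^bsub>\<Omega>\<^esub>" for a b
  proof -
    obtain c d where "c \<noteq> d" and cd: "opposite_vertices a b = {c, d}" and no4: "{a, b, c, d} \<notin> ?K"
      using two_opposite_vertices[OF simplex2[OF ab(1-4,6)] ab(5)] .
    have eq: "opposite_vertices a b = common_annihilator a b - {\<zero>\<^bsub>\<Omega>\<^esub>, a, b}"
      using ab m_comm by (auto simp: K nonzero_zero_divisors_def)
    \<comment> \<open>Adjacent opposite vertices would span a tetrahedron.\<close>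
    moreover have "c \<otimes>\<^bsub>\<Omega>\<^esub> d \<noteq> \<zero>\<^bsub>\<Omega>\<^esub>"
    proof
      assume "c \<otimes>\<^bsub>\<Omega>\<^esub> d = \<zero>\<^bsub>\<Omega>\<^esub>"
      moreover have c: "c \<in> common_annihilator a b - {\<zero>\<^bsub>\<Omega>\<^esub>, a, b}" "{a, b, c} \<in> ?K"
        and d: "d \<in> common_annihilator a b - {\<zero>\<^bsub>\<Omega>\<^esub>, a, b}" "{a, b, d} \<in> ?K"
        using cd eq by auto
      ultimately have "d \<otimes>\<^bsub>\<Omega>\<^esub> c = \<zero>\<^bsub>\<Omega>\<^esub>"
        using m_comm by auto
      then have "{a, b, c, d} \<in> ?K"
        using c d \<open>c \<otimes>\<^bsub>\<Omega>\<^esub> d = \<zero>\<^bsub>\<Omega>\<^esub>\<close> by (auto simp: K)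
      then show False
        using no4 by simp
    qed
    ultimately show ?thesis
      using \<open>c \<noteq> d\<close> cd by metis
  qed
  have "topspace (geometric_realization ?K) \<noteq> {}"
    using hom \<open>topspace S \<noteq> {}\<close> homeomorphic_empty_space by force
  then obtain \<sigma> where "\<sigma> \<in> ?K"
    unfolding topspace_geometric_realization by blast
  moreover from this obtain a where "a \<in> \<sigma>"
    using K[of \<sigma>] by auto
  ultimately have "{a} \<in> ?K"
    using face[of \<sigma> "{a}"] by simp
  then obtain b where "b \<noteq> a" "{a, b} \<in> ?K"
    by (rule vertex_in_edge)
  then have "a \<in> carrier \<Omega>" "b \<in> carrier \<Omega>" "a \<noteq> \<zero>\<^bsub>\<Omega>\<^esub>" "b \<noteq> \<zero>\<^bsub>\<Omega>\<^esub>" "a \<noteq> b" "a \<otimes>\<^bsub>\<Omega>\<^esub> b = \<zero>\<^bsub>\<Omega>\<^esub>"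
    unfolding K nonzero_zero_divisors_def by auto
  then show False
    by (intro edge_links_not_all_two_nonadjacent_vertices[of a b] exactly_two)
qed

end
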